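(* Let $n\ge 1$, $N=2^n$, let $z\in\{0,1\}^n$, and let $\mathcal{U}$ be an arbitrary unitary operator on $(\mathbb{C}^2)^{\otimes n}$. Let $\rho^0=|0^n\rangle\langle 0^n|$ be the input state, $\rho^{\mathcal{U}}=\mathcal{U}\rho^0\mathcal{U}^\dagger$, and let $\delta=|\psi\rangle\langle\psi|$ with $|\psi\rangle=\mathcal{U}|0^n\rangle$ be the initial state of the generalized Bernstein-Vazirani (GBV) algorithm with secret string $z$. Then the coherence fraction of the operator $\mathcal{U}$ with respect to the input state $\rho^0$ is $$C_{\mathcal{F}}(\rho^{\mathcal{U}})=P_{\mathrm{succ}}^{G}(\delta).$$
   Context: Basis states $|x\rangle$, $0\le x\le N-1$, of $(\mathbb{C}^2)^{\otimes n}$ are identified with bit strings $x\in\{0,1\}^n$ via binary representation; $|0^n\rangle$ is the all-zero basis state. For the secret string $z\in\{0,1\}^n$ let $\ell(x)=z\cdot x \bmod 2$, where $z\cdot x=\sum_{k=1}^n z_kx_k$. The oracle $\mathcal{O}_\ell$ is the unitary on $(\mathbb{C}^2)^{\otimes n}$ with $\mathcal{O}_\ell|x\rangle=(-1)^{\ell(x)}|x\rangle$. $H$ is the single-qubit Hadamard gate, so $H^{\otimes n}|x\rangle=\frac{1}{\sqrt N}\sum_{y=0}^{N-1}(-1)^{x\cdot y}|y\rangle$. GBV algorithm: start from $|0^n\rangle$, apply an arbitrary unitary $\mathcal{U}$ to get the initial state $|\psi\rangle=\mathcal{U}|0^n\rangle$, apply $\mathcal{O}_\ell$, apply $H^{\otimes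 n}$, and measure in the computational basis (the ancilla qubit is omitted since its state is unchanged by the oracle). The algorithm succeeds if the outcome is $z$; its success probability is $$P_{\mathrm{succ}}^{G}(\delta)=\left|\langle z|H^{\otimes n}\mathcal{O}_\ell\,\mathcal{U}|0^n\rangle\right|^2,\qquad \delta=|\psi\rangle\langle\psi|.$$ State coherence fraction: for a density operator $\rho$ on $(\mathbb{C}^2)^{\otimes n}$, $C_{\mathcal F}(\rho):=\langle\eta|\rho|\eta\rangle$, where $|\eta\rangle=\frac{1}{\sqrt N}\sum_{x=0}^{N-1}|x\rangle$. Operator coherence fraction: the coherence fraction of a unitary $U$ with respect to a pure state $\rho=|\phi\rangle\langle\phi|$ is $C_{\mathcal F}(\rho^{U}):=C_{\mathcal F}(U\rho U^\dagger)$. *)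

theory Defs
  imports "Jordan_Normal_Form.Schur_Decomposition"
begin

text \<open>
  States and operators on n qubits are vectors of dimension \<open>2 ^ n\<close> and
  \<open>2 ^ n\<close> by \<open>2 ^ n\<close> matrices over the complex numbers. A bit string
  \<open>x_1 ... x_n\<close> is identified with the number \<open>x < 2 ^ n\<close> that it denotes in binary,
  with \<open>x_1\<close> the most significant bit.
\<close>

definition ket :: "nat \<Rightarrow> nat \<Rightarrow> complex vec" where
  "ket n x = unit_vec (2 ^ n) x"

text \<open>The inner product, conjugate linear in the first argument; the library's
  \<open>\<bullet>c\<close> conjugates its second argument.\<close>

definition braket :: "complex vec \<Rightarrow> complex vec \<Rightarrow> complex" where
  "braket u v = v \<bullet>c u"

definition ketbra :: "complex vec \<Rightarrow> complex vec \<Rightarrow> complex mat" where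
  "ketbra u v = mat (dim_vec u) (dim_vec v) (\<lambda>(i, j). u $ i * cnj (v $ j))"

definition unitary_op :: "nat \<Rightarrow> complex mat \<Rightarrow> bool" where
  "unitary_op n U \<longleftrightarrow> U \<in> carrier_mat (2 ^ n) (2 ^ n) \<and>
     U * mat_adjoint U = 1\<^sub>m (2 ^ n) \<and> mat_adjoint U * U = 1\<^sub>m (2 ^ n)"

definition bit_at :: "nat \<Rightarrow> nat \<Rightarrow> nat \<Rightarrow> nat" where
  "bit_at n x k = (x div 2 ^ (n - k)) mod 2"

definition bit_dot :: "nat \<Rightarrow> nat \<Rightarrow> nat \<Rightarrow> nat" where
  "bit_dot n z x = (\<Sum>k=1..n. bit_at n z k * bit_at n x k)"

definition oracle_fun :: "nat \<Rightarrow> nat \<Rightarrow> nat \<Rightarrow> nat" where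
  "oracle_fun n z x = bit_dot n z x mod 2"

definition phase_oracle :: "nat \<Rightarrow> (nat \<Rightarrow> nat) \<Rightarrow> complex mat" where
  "phase_oracle n l = mat_diag (2 ^ n) (\<lambda>x. (-1) ^ l x)"

text \<open>The Kronecker product in which the left factor acts on the more significant bits.\<close>

definition kronecker :: "complex mat \<Rightarrow> complex mat \<Rightarrow> complex mat" where
  "kronecker A B = mat (dim_row A * dim_row B) (dim_col A * dim_col B)
     (\<lambda>(i, j). A $$ (i div dim_row B, j div dim_col B) * B $$ (i mod dim_row B, j mod dim_col B))"

primrec tensor_pow :: "complex mat \<Rightarrow> nat \<Rightarrow> complex mat" where
  "tensor_pow A 0 = 1\<^sub>m 1"
| "tensor_pow A (Suc n) = kronecker A (tensor_pow A n)"

definition hadamard :: "complex mat" where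
  "hadamard = complex_of_real (1 / sqrt 2) \<cdot>\<^sub>m mat_of_rows_list 2 [[1, 1], [1, -1]]"

definition gbv_initial_state :: "nat \<Rightarrow> complex mat \<Rightarrow> complex vec" where
  "gbv_initial_state n U = U *\<^sub>v ket n 0"

definition gbv_final_state :: "nat \<Rightarrow> nat \<Rightarrow> complex vec \<Rightarrow> complex vec" where
  "gbv_final_state n z \<psi> =
     tensor_pow hadamard n *\<^sub>v (phase_oracle n (oracle_fun n z) *\<^sub>v \<psi>)"

text \<open>
  The success probability takes a vector \<open>\<psi>\<close> representing the pure initial state
  \<open>ketbra \<psi> \<psi>\<close>; by \<open>gbv_success_prob_cong\<close> below it depends only on that
  density operator.
\<close>

definition gbv_success_prob :: "nat \<Rightarrow> nat \<Rightarrow> complex vec \<Rightarrow> real" where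
  "gbv_success_prob n z \<psi> = (cmod (braket (ket n z) (gbv_final_state n z \<psi>)))\<^sup>2"

definition uniform_state :: "nat \<Rightarrow> complex vec" where
  "uniform_state n = vec (2 ^ n) (\<lambda>_. complex_of_real (1 / sqrt (2 ^ n)))"

text \<open>Complex-valued; on density operators the value is real.\<close>

definition coherence_fraction :: "nat \<Rightarrow> complex mat \<Rightarrow> complex" where
  "coherence_fraction n \<rho> = braket (uniform_state n) (\<rho> *\<^sub>v uniform_state n)"

definition evolve :: "complex mat \<Rightarrow> complex mat \<Rightarrow> complex mat" where
  "evolve U \<rho> = U * \<rho> * mat_adjoint U"

definition op_coherence_fraction :: "nat \<Rightarrow> complex mat \<Rightarrow> complex mat \<Rightarrow> complex" where
  "op_coherence_fraction n U \<rho> = coherence_fraction n (evolve U \<rho>)"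

lemma tensor_pow_carrier:
  assumes "A \<in> carrier_mat 2 2"
  shows "tensor_pow A n \<in> carrier_mat (2 ^ n) (2 ^ n)"
proof (induction n)
  case 0
  then show ?case by simp
next
  case (Suc n)
  then have "dim_row (tensor_pow A n) = 2 ^ n" "dim_col (tensor_pow A n) = 2 ^ n"
    by (rule carrier_matD)+
  with carrier_matD[OF assms] show ?case
    by (intro carrier_matI) (simp_all add: kronecker_def)
qed

lemma hadamard_carrier: "hadamard \<in> carrier_mat 2 2"
  by (rule carrier_matI) (simp_all add: hadamard_def mat_of_rows_list_def)

lemma braket_ket:
  assumes "v \<in> carrier_vec (2 ^ n)" "x < 2 ^ n"
  shows "braket (ket n x) v = v $ x"
proof -
  have "(\<Sum>i = 0..<2 ^ n. v $ i * cnj (unit_vec (2 ^ n) x $ i)) =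
      (\<Sum>i = 0..<2 ^ n. if i = x then v $ x else 0)"
    by (rule sum.cong) (auto simp: assms)
  then show ?thesis
    using assms by (simp add: braket_def ket_def scalar_prod_def)
qed

lemma gbv_success_prob_cong:
  assumes "\<psi> \<in> carrier_vec (2 ^ n)" "\<phi> \<in> carrier_vec (2 ^ n)" "z < 2 ^ n"
    and "ketbra \<psi> \<psi> = ketbra \<phi> \<phi>"
  shows "gbv_success_prob n z \<psi> = gbv_success_prob n z \<phi>"
proof -
  define M where "M = tensor_pow hadamard n * phase_oracle n (oracle_fun n z)"
  have O: "phase_oracle n (oracle_fun n z) \<in> carrier_mat (2 ^ n) (2 ^ n)"
    by (simp add: phase_oracle_def mat_diag_def)
  note T = tensor_pow_carrier[OF hadamard_carrier, of n]
  have M: "M \<in> carrier_mat (2 ^ n) (2 ^ n)"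
    unfolding M_def using T O by (rule mult_carrier_mat)
  have *: "complex_of_real (gbv_success_prob n z v) =
      (\<Sum>j = 0..<2 ^ n. \<Sum>k = 0..<2 ^ n.
         M $$ (z, j) * cnj (M $$ (z, k)) * (ketbra v v $$ (j, k)))"
    if v: "v \<in> carrier_vec (2 ^ n)" for v
  proof -
    have "gbv_final_state n z v = M *\<^sub>v v"
      unfolding gbv_final_state_def M_def using T O v
      by (simp add: assoc_mult_mat_vec)
    then have "braket (ket n z) (gbv_final_state n z v) =
        (\<Sum>j = 0..<2 ^ n. M $$ (z, j) * v $ j)"
      using M v assms(3) by (simp add: braket_ket[OF mult_mat_vec_carrier[OF M v]] scalar_prod_def)
    then show ?thesis
      using v unfolding gbv_success_prob_def complex_norm_square
      by (simp add: sum_product ketbra_def mult_ac)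
  qed
  show ?thesis
    using *[OF assms(1)] *[OF assms(2)] assms(4) of_real_eq_iff by metis
qed

end

theory Submission
  imports Defs
begin

text \<open>
  The row of \<open>z\<close> in the Walsh-Hadamard matrix carries the signs \<open>(-1) ^ (z \<cdot> y)\<close>, which are
  exactly those applied by the oracle, so they cancel and the amplitude of \<open>z\<close> in the final
  state is \<open>N powr (-1/2)\<close> times the sum of the amplitudes of \<open>\<psi>\<close>, i.e. the overlap of \<open>\<psi>\<close>
  with the uniform state. The coherence fraction of the pure state \<open>\<psi>\<close> is the squared modulus of
  that same overlap.
\<close>

lemma bit_at_Suc_1: "bit_at (Suc n) x (Suc 0) = x div 2 ^ n mod 2"
  by (simp add: bit_at_def)

text \<open>Bits are numbered from the most significant one, so \<open>Suc k\<close> out of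
  \<open>Suc n\<close> and \<open>k\<close> out of \<open>n\<close> both select the binary place
  \<open>n - k\<close>. Since \<open>k\<close> is at least 1, this place lies below \<open>n\<close>
  and survives the reduction modulo \<open>2 ^ n\<close>.\<close>

lemma bit_at_Suc_Suc:
  assumes "1 \<le> k" "k \<le> n"
  shows "bit_at (Suc n) x (Suc k) = bit_at n (x mod 2 ^ n) k"
proof -
  have "bit (take_bit n x) (n - k) \<longleftrightarrow> bit x (n - k)"
    using assms by (auto simp: bit_take_bit_iff)
  then have "odd (x mod 2 ^ n div 2 ^ (n - k)) \<longleftrightarrow> odd (x div 2 ^ (n - k))"
    by (simp add: bit_iff_odd take_bit_eq_mod)
  then show ?thesis
    by (simp add: bit_at_def mod2_eq_if)
qed

text \<open>Splitting off the leading bit mirrors the recursion of \<open>tensor_pow\<close>, whose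
  new factor acts on the most significant bit.\<close>

lemma bit_dot_Suc:
  "bit_dot (Suc n) i j =
    (i div 2 ^ n mod 2) * (j div 2 ^ n mod 2) + bit_dot n (i mod 2 ^ n) (j mod 2 ^ n)"
proof -
  have "bit_dot (Suc n) i j = bit_at (Suc n) i 1 * bit_at (Suc n) j 1
      + (\<Sum>k=Suc 1..Suc n. bit_at (Suc n) i k * bit_at (Suc n) j k)"
    unfolding bit_dot_def by (rule sum.atLeast_Suc_atMost) simp
  also have "(\<Sum>k=Suc 1..Suc n. bit_at (Suc n) i k * bit_at (Suc n) j k) =
      (\<Sum>k=1..n. bit_at (Suc n) i (Suc k) * bit_at (Suc n) j (Suc k))"
    by (rule sum.shift_bounds_cl_Suc_ivl)
  also have "\<dots> = bit_dot n (i mod 2 ^ n) (j mod 2 ^ n)"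
    unfolding bit_dot_def by (intro sum.cong refl) (simp add: bit_at_Suc_Suc)
  finally show ?thesis
    by (simp add: bit_at_Suc_1)
qed

text \<open>Writing the sign as a power makes exponents add up under the Kronecker product.\<close>

lemma hadamard_entry:
  assumes "i < 2" "j < 2"
  shows "hadamard $$ (i, j) = complex_of_real (1 / sqrt 2) * (-1) ^ (i * j)"
  using assms by (auto simp: hadamard_def mat_of_rows_list_def less_2_cases_iff)

lemma tensor_pow_hadamard_entry:
  assumes "i < 2 ^ n" "j < 2 ^ n"
  shows "tensor_pow hadamard n $$ (i, j) = complex_of_real (1 / sqrt (2 ^ n)) * (-1) ^ bit_dot n i j"
  using assms
proof (induction n arbitrary: i j)
  case 0
  then show ?case by (simp add: bit_dot_def)
next
  case (Suc n)
  have dims: "dim_row (tensor_pow hadamard n) = 2 ^ n" "dim_col (tensor_pow hadamard n) = 2 ^ n"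
    "dim_row hadamard = 2" "dim_col hadamard = 2"
    using tensor_pow_carrier[OF hadamard_carrier, of n] hadamard_carrier by auto
  \<comment> \<open>The quotients are single bits, so \<open>hadamard_entry\<close> applies and the
    \<open>mod 2\<close> in \<open>bit_dot_Suc\<close> has no effect.\<close>
  have q: "i div 2 ^ n < 2" "j div 2 ^ n < 2"
    using Suc.prems by (simp_all add: less_mult_imp_div_less)
  have "tensor_pow hadamard (Suc n) $$ (i, j) =
      hadamard $$ (i div 2 ^ n, j div 2 ^ n) * tensor_pow hadamard n $$ (i mod 2 ^ n, j mod 2 ^ n)"
    using Suc.prems by (simp add: kronecker_def dims)
  also have "\<dots> = complex_of_real (1 / sqrt 2 * (1 / sqrt (2 ^ n))) * (-1) ^ bit_dot (Suc n) i j"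
    using q by (simp add: hadamard_entry Suc.IH bit_dot_Suc power_add)
  finally show ?case
    by (simp add: real_sqrt_mult)
qed

lemma braket_uniform:
  assumes "v \<in> carrier_vec (2 ^ n)"
  shows "braket (uniform_state n) v = complex_of_real (1 / sqrt (2 ^ n)) * (\<Sum>y = 0..<2 ^ n. v $ y)"
  using assms
  by (simp add: braket_def uniform_state_def scalar_prod_def sum_distrib_left mult.commute)

lemma gbv_final_amplitude:
  assumes v: "v \<in> carrier_vec (2 ^ n)" and z: "z < 2 ^ n"
  shows "braket (ket n z) (gbv_final_state n z v) = braket (uniform_state n) v"
proof -
  let ?H = "tensor_pow hadamard n" and ?O = "phase_oracle n (oracle_fun n z)"
  note H = tensor_pow_carrier[OF hadamard_carrier, of n]
  have O: "?O \<in> carrier_mat (2 ^ n) (2 ^ n)"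
    by (simp add: phase_oracle_def mat_diag_def)
  have Ov: "?O *\<^sub>v v \<in> carrier_vec (2 ^ n)"
    using O v by simp
  have Ovy: "(?O *\<^sub>v v) $ y = (-1) ^ oracle_fun n z y * v $ y" if "y < 2 ^ n" for y
  proof -
    have "(?O *\<^sub>v v) $ y =
        (\<Sum>k = 0..<2 ^ n. (if y = k then (-1) ^ oracle_fun n z k else 0) * v $ k)"
      using that v by (simp add: phase_oracle_def mat_diag_def scalar_prod_def)
    also have "\<dots> = (\<Sum>k = 0..<2 ^ n. if y = k then (-1) ^ oracle_fun n z k * v $ k else 0)"
      by (rule sum.cong) simp_all
    finally show ?thesis using that by simp
  qed
  have "braket (ket n z) (gbv_final_state n z v) = (?H *\<^sub>v (?O *\<^sub>v v)) $ z"
    unfolding gbv_final_state_def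
    using mult_mat_vec_carrier[OF H Ov] z by (rule braket_ket)
  also have "\<dots> = (\<Sum>y = 0..<2 ^ n. ?H $$ (z, y) * ((-1) ^ oracle_fun n z y * v $ y))"
    using H Ov z v O Ovy by (simp add: scalar_prod_def)
  also have "\<dots> = (\<Sum>y = 0..<2 ^ n. complex_of_real (1 / sqrt (2 ^ n)) * v $ y)"
  proof (rule sum.cong[OF refl])
    fix y assume "y \<in> {0..<(2::nat) ^ n}"
    \<comment> \<open>Both exponents have the same parity, so the product is the square of a
      sign.\<close>
    moreover have "(-1) ^ bit_dot n z y * (-1) ^ oracle_fun n z y = (1::complex)"
      by (cases "even (bit_dot n z y)") (simp_all add: oracle_fun_def mod2_eq_if)
    ultimately show "?H $$ (z, y) * ((-1) ^ oracle_fun n z y * v $ y) =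
        complex_of_real (1 / sqrt (2 ^ n)) * v $ y"
      using z by (simp add: tensor_pow_hadamard_entry mult.assoc[symmetric] del: mult.assoc)
  qed
  also have "\<dots> = braket (uniform_state n) v"
    by (simp add: braket_uniform[OF v] sum_distrib_left)
  finally show ?thesis .
qed

lemma evolve_ketbra:
  assumes U: "U \<in> carrier_mat m m" and u: "u \<in> carrier_vec m"
  shows "evolve U (ketbra u u) = ketbra (U *\<^sub>v u) (U *\<^sub>v u)"
proof (rule eq_matI)
  fix i j assume "i < dim_row (ketbra (U *\<^sub>v u) (U *\<^sub>v u))" "j < dim_col (ketbra (U *\<^sub>v u) (U *\<^sub>v u))"
  then have ij: "i < m" "j < m"
    using U by (simp_all add: ketbra_def)
  have "evolve U (ketbra u u) $$ (i, j) =
      (\<Sum>k = 0..<m. (\<Sum>l = 0..<m. U $$ (i, l) * (u $ l * cnj (u $ k))) * cnj (U $$ (j, k)))"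
    using U u ij by (simp add: evolve_def ketbra_def mat_adjoint_def mat_of_rows_def scalar_prod_def)
  also have "\<dots> = (\<Sum>k = 0..<m. (\<Sum>l = 0..<m. U $$ (i, l) * u $ l) * cnj (U $$ (j, k) * u $ k))"
    by (simp add: sum_distrib_left sum_distrib_right mult_ac)
  also have "\<dots> = (U *\<^sub>v u) $ i * cnj ((U *\<^sub>v u) $ j)"
    using U u ij by (simp add: scalar_prod_def sum_distrib_left)
  finally show "evolve U (ketbra u u) $$ (i, j) = ketbra (U *\<^sub>v u) (U *\<^sub>v u) $$ (i, j)"
    using U ij by (simp add: ketbra_def)
qed (use U in \<open>simp_all add: evolve_def ketbra_def mat_adjoint_def\<close>)

lemma coherence_fraction_ketbra:
  assumes v: "v \<in> carrier_vec (2 ^ n)"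
  shows "coherence_fraction n (ketbra v v) = complex_of_real ((cmod (braket (uniform_state n) v))\<^sup>2)"
proof -
  let ?c = "complex_of_real (1 / sqrt (2 ^ n))"
  let ?S = "\<Sum>y = 0..<2 ^ n. v $ y"
  have dim: "ketbra v v \<in> carrier_mat (2 ^ n) (2 ^ n)"
    using v by (simp add: ketbra_def)
  \<comment> \<open>The operator has rank at most one: it sends the uniform state to
    \<open>v\<close> times their inner product, which is \<open>cnj ?S * ?c\<close>.\<close>
  have "ketbra v v *\<^sub>v uniform_state n = (cnj ?S * ?c) \<cdot>\<^sub>v v"
    by (rule eq_vecI)
      (use v in \<open>simp_all add: ketbra_def uniform_state_def scalar_prod_def
        sum_distrib_left sum_distrib_right mult_ac\<close>)
  then have "coherence_fraction n (ketbra v v) = braket (uniform_state n) ((cnj ?S * ?c) \<cdot>\<^sub>v v)"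
    by (simp add: coherence_fraction_def)
  also have "\<dots> = (cnj ?S * ?c) * (?c * ?S)"
  proof -
    \<comment> \<open>The scalar is kept generic so that distributing over sums does not expand the
      sum inside it.\<close>
    have "braket (uniform_state n) (a \<cdot>\<^sub>v v) = a * (?c * ?S)" for a
      using v by (simp add: braket_uniform sum_distrib_left mult_ac)
    then show ?thesis .
  qed
  \<comment> \<open>The factor \<open>?c\<close> is real, hence fixed by conjugation.\<close>
  also have "\<dots> = (?c * ?S) * cnj (?c * ?S)"
    by simp
  also have "\<dots> = complex_of_real ((cmod (braket (uniform_state n) v))\<^sup>2)"
    by (simp only: braket_uniform[OF v] complex_norm_square)
  finally show ?thesis .
qed

theorem theorem2:
  fixes n z :: nat and U \<rho>\<^sub>0 :: "complex mat" and \<psi> :: "complex vec"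
  assumes "n \<ge> 1"
    and "z < 2 ^ n"
    and "unitary_op n U"
    and "\<rho>\<^sub>0 = ketbra (ket n 0) (ket n 0)"
    and "\<psi> = gbv_initial_state n U"
  shows "op_coherence_fraction n U \<rho>\<^sub>0 = complex_of_real (gbv_success_prob n z \<psi>)"
proof -
  have U: "U \<in> carrier_mat (2 ^ n) (2 ^ n)"
    using assms(3) by (simp add: unitary_op_def)
  have ket: "ket n 0 \<in> carrier_vec (2 ^ n)"
    by (simp add: ket_def)
  have \<psi>: "\<psi> \<in> carrier_vec (2 ^ n)"
    using U ket by (simp add: assms(5) gbv_initial_state_def)
  have "op_coherence_fraction n U \<rho>\<^sub>0 = coherence_fraction n (ketbra \<psi> \<psi>)"
    by (simp add: op_coherence_fraction_def assms(4,5) gbv_initial_state_def evolve_ketbra[OF U ket])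
  also have "\<dots> = complex_of_real (gbv_success_prob n z \<psi>)"
    by (simp only: coherence_fraction_ketbra[OF \<psi>] gbv_success_prob_def
        gbv_final_amplitude[OF \<psi> assms(2)])
  finally show ?thesis .
qed

end
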